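(* Let $k\in\{1,2\}$, $\alpha_k=\frac{5k+2}{2k+1}$, $x_k(n)=\frac{\pi\sqrt{24n-(2k+2)}}{6}$, $M_k(n)=\frac{\alpha_k\pi^3}{18\,x_k(n)^2}I_2\big(\sqrt{\alpha_k}\,x_k(n)\big)$ where $I_2$ is the modified Bessel function of the first kind of order $2$, and $\Lambda_k(n)=\frac{M_k(n-1)M_k(n+1)}{M_k(n)^2}$. Then for all integers $n\ge 2$, writing $x=x_k(n)$ and $\alpha=\alpha_k$, \[ \Lambda_k(n)<\left(1+\frac{5\pi^4}{9x^4}+\frac{\pi^8}{3x^8}\right)\left(1-\frac{\sqrt{\alpha}\pi^4}{9x^3}+\frac{\alpha\pi^8}{81x^6}\right)\left(1-\frac{5\pi^4}{8\sqrt{\alpha}x^5}+\frac{292}{\alpha^3x^6}\right), \] and \[ \Lambda_k(n)>\left(1+\frac{5\pi^4}{9x^4}+\frac{5\pi^8}{18x^8}\right)\left(1-\frac{\sqrt{\alpha}\pi^4}{9x^3}-\frac{5\sqrt{\alpha}\pi^8}{162x^7}\right)\left(1-\frac{5\pi^4}{8\sqrt{\alpha}x^5}-\frac{5\pi^4}{6\alpha x^6}-\frac{300}{\alpha^3x^6}\right). \] *)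

theory Defs
  imports "HOL-Analysis.Analysis"
begin

text \<open>Modified Bessel function of the first kind, given by its power series at nonnegative integer
  order, where \<open>\<Gamma>(m + \<nu> + 1) = (m + \<nu>)!\<close>.\<close>

definition bessel_I :: "nat \<Rightarrow> real \<Rightarrow> real" where
  "bessel_I \<nu> s = (\<Sum>m. (s / 2) ^ (2 * m + \<nu>) / (fact m * fact (m + \<nu>)))"

definition alpha_k :: "nat \<Rightarrow> real" where
  "alpha_k k = (5 * real k + 2) / (2 * real k + 1)"

definition x_k :: "nat \<Rightarrow> int \<Rightarrow> real" where
  "x_k k n = pi * sqrt (24 * of_int n - (2 * real k + 2)) / 6"

definition M_k :: "nat \<Rightarrow> int \<Rightarrow> real" where
  "M_k k n = alpha_k k * pi ^ 3 / (18 * (x_k k n)\<^sup>2) * bessel_I 2 (sqrt (alpha_k k) * x_k k n)"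

definition Lambda_k :: "nat \<Rightarrow> int \<Rightarrow> real" where
  "Lambda_k k n = M_k k (n - 1) * M_k k (n + 1) / (M_k k n)\<^sup>2"

end

theory Submission
  imports Defs
begin

text \<open>
  Up to a constant factor, \<open>M\<^sub>k\<close> is \<open>I\<^sub>2(\<surd>v) / v\<close> at \<open>v = \<alpha> x\<^sup>2\<close>, and \<open>n \<plusminus> 1\<close> corresponds to
  \<open>v (1 \<plusminus> t)\<close> with \<open>t = 24 / (24 n - 2 k - 2)\<close>; so \<open>ln \<Lambda>\<^sub>k\<close> is a second difference of
  \<open>L v = ln (I\<^sub>2(\<surd>v) / v)\<close> up to an additive constant in \<open>L\<close>. Because \<open>L''\<close> is an algebraic function of
  \<open>v\<close> and \<open>I\<^sub>2' / I\<^sub>2\<close>, two rational bounds of this quotient make \<open>L - \<phi>\<close> concave for \<open>c = 1\<close> and convex for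
  \<open>c = - 5/2\<close>, where \<open>\<phi> v = \<surd>v - 5/4 ln v - 15 / (8 \<surd>v) + c / v\<close> is the truncated asymptotic
  expansion of \<open>L\<close>. The rational bounds come from comparing the Bessel equation with explicit
  functions \<open>exp s \<cdot> P(s) powr - \<kappa>\<close>: a Wronskian that vanishes at 0 turns out to be monotone. The
  second difference of \<open>\<phi>\<close> is elementary, and with \<open>s = \<surd>v\<close> and \<open>s\<^sup>2 t = 2 \<alpha> \<pi>\<^sup>2 / 3\<close> constant the error
  terms, all of order \<open>t\<^sup>3\<close>, are absorbed by the quadratic term of \<open>exp (- s t\<^sup>2 / 4)\<close>.
\<close>

section \<open>The normalised Bessel series\<close>

text \<open>The regularised hypergeometric function 0F1(; n + 1; w). In this normalisation
  differentiation just raises \<open>n\<close> by one.\<close>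

definition hyp :: "nat \<Rightarrow> real \<Rightarrow> real" where
  "hyp n w = (\<Sum>m. w ^ m / (fact m * fact (m + n)))"

lemma summable_hyp: "summable (\<lambda>m. (w::real) ^ m / (fact m * fact (m + n)))"
proof (rule summable_comparison_test')
  show "summable (\<lambda>m. \<bar>w\<bar> ^ m / fact m)"
    using summable_exp[of "\<bar>w\<bar>"] by (simp add: field_simps)
  show "norm (w ^ m / (fact m * fact (m + n))) \<le> \<bar>w\<bar> ^ m / fact m" for m
  proof -
    have "fact m * 1 \<le> (fact m * fact (m + n) :: real)"
      by (intro mult_left_mono) auto
    then show ?thesis
      by (auto simp: abs_mult power_abs intro!: divide_left_mono)
  qed
qed

lemma has_field_derivative_hyp: "(hyp n has_field_derivative hyp (Suc n) w) (at w)"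
proof -
  define c where "c = (\<lambda>m. 1 / (fact m * fact (m + n)) :: real)"
  have "diffs c m = 1 / (fact m * fact (m + Suc n))" for m
    by (simp add: diffs_def c_def divide_simps)
  then have d: "diffs c = (\<lambda>m. 1 / (fact m * fact (m + Suc n)))" ..
  have "((\<lambda>x. \<Sum>m. c m * x ^ m) has_field_derivative (\<Sum>m. diffs c m * w ^ m)) (at w)"
    by (rule termdiffs_strong_converges_everywhere) (use summable_hyp in \<open>simp add: c_def\<close>)
  then show ?thesis
    unfolding d by (simp add: c_def hyp_def[abs_def])
qed

text \<open>Coefficientwise this is 1/(m+n)! = ((n+1) + m)/(m+n+1)!. In the second summand the
  factor m cancels against m!, and an index shift produces the factor \<open>w\<close>.\<close>

lemma hyp_recurrence: "hyp n w = real (Suc n) * hyp (Suc n) w + w * hyp (Suc (Suc n)) w"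
proof -
  let ?a = "\<lambda>n m. w ^ m / (fact m * fact (m + n))"
  let ?b = "\<lambda>m. real m * w ^ m / (fact m * fact (m + Suc n))"
  have b_Suc: "?b (Suc m) = w * ?a (Suc (Suc n)) m" for m
    by (simp add: divide_simps)
  have summ_b: "summable ?b"
    by (subst summable_Suc_iff[symmetric], unfold b_Suc) (intro summable_mult summable_hyp)
  have "?a n m = real (Suc n) * ?a (Suc n) m + ?b m" for m
    by (simp add: divide_simps) (simp add: algebra_simps)
  then have "hyp n w = (\<Sum>m. real (Suc n) * ?a (Suc n) m + ?b m)"
    by (simp add: hyp_def)
  also have "\<dots> = real (Suc n) * hyp (Suc n) w + suminf ?b"
    unfolding hyp_def
    by (subst suminf_mult[symmetric], rule summable_hyp, rule suminf_add[symmetric])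
      (intro summable_mult summable_hyp summ_b)+
  also have "suminf ?b = w * hyp (Suc (Suc n)) w"
    using suminf_split_head[OF summ_b, unfolded b_Suc] suminf_mult[OF summable_hyp[of w "Suc (Suc n)"], of w]
    by (simp add: hyp_def)
  finally show ?thesis .
qed

lemma hyp_pos: "0 < hyp n w" if "0 \<le> w"
  unfolding hyp_def
  by (rule suminf_pos2[OF summable_hyp, of _ _ 0]) (use that in auto)

lemma bessel_I_eq_hyp: "bessel_I n s = (s / 2) ^ n * hyp n (s\<^sup>2 / 4)"
proof -
  have half_sq: "s\<^sup>2 / 4 = (s / 2)\<^sup>2"
    by (simp add: power_divide)
  have "(s / 2) ^ (2 * m + n) = (s / 2) ^ n * (s\<^sup>2 / 4) ^ m" for m
    unfolding half_sq power_add power_mult by (rule mult.commute)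
  then show ?thesis
    unfolding bessel_I_def hyp_def
    by (subst suminf_mult[symmetric], intro summable_hyp) simp
qed

text \<open>\<open>J s = I\<^sub>2(s) / (s/2)\<^sup>2\<close>, the entire solution of \<open>s J'' + 5 J' = s J\<close>, and its derivative.\<close>

definition J :: "real \<Rightarrow> real" where "J s = hyp 2 (s\<^sup>2 / 4)"
definition J' :: "real \<Rightarrow> real" where "J' s = s / 2 * hyp 3 (s\<^sup>2 / 4)"

lemma J_pos: "0 < J s"
  by (simp add: J_def hyp_pos)

lemma deriv_hyp_sq:
  "((\<lambda>s. hyp n (s\<^sup>2 / 4)) has_real_derivative s / 2 * hyp (Suc n) (s\<^sup>2 / 4)) (at s)"
  by (rule DERIV_cong, rule DERIV_chain2[OF has_field_derivative_hyp])
    (auto intro!: derivative_eq_intros)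

lemma deriv_J: "(J has_real_derivative J' s) (at s)"
  unfolding J_def[abs_def] J'_def using deriv_hyp_sq[of 2] by (simp add: eval_nat_numeral)

lemma deriv_J': "(J' has_real_derivative hyp 3 (s\<^sup>2 / 4) / 2 + s\<^sup>2 / 4 * hyp 4 (s\<^sup>2 / 4)) (at s)"
  unfolding J'_def[abs_def]
  by (rule derivative_eq_intros deriv_hyp_sq refl | simp add: eval_nat_numeral)+

text \<open>The bracket is J'', so this is the Bessel equation for \<open>J\<close>; it is the case
  n = 2 of the recurrence.\<close>

lemma J_ode: "s * (hyp 3 (s\<^sup>2 / 4) / 2 + s\<^sup>2 / 4 * hyp 4 (s\<^sup>2 / 4)) = s * J s - 5 * J' s"
  using hyp_recurrence[of 2 "s\<^sup>2 / 4"] by (simp add: J_def J'_def field_simps)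

text \<open>The sign \<open>\<sigma> = \<plusminus>1\<close> covers sub- and supersolutions at once. The derivative of
  \<open>s\<^sup>5 (J' K - J K')\<close> is \<open>s\<^sup>4 J K\<close> times the defect of \<open>K\<close> in the equation for \<open>J\<close>.\<close>

lemma log_deriv_compare:
  fixes K k k' :: "real \<Rightarrow> real" and \<sigma> s :: real
  assumes s: "0 < s"
    and K: "\<And>x. 0 \<le> x \<Longrightarrow> 0 < K x" "\<And>x. 0 \<le> x \<Longrightarrow> (K has_real_derivative K x * k x) (at x)"
    and k: "\<And>x. 0 \<le> x \<Longrightarrow> (k has_real_derivative k' x) (at x)"
    and le: "\<And>x. 0 \<le> x \<Longrightarrow> 0 \<le> \<sigma> * (x - 5 * k x - x * (k x)\<^sup>2 - x * k' x)"
  shows "0 \<le> \<sigma> * (J' s / J s - k s)"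
proof -
  \<comment> \<open>The weight x^5 is the integrating factor of J'' + (5/x) J'. It also makes
    \<open>N\<close> vanish at 0, so monotonicity of \<open>N\<close> gives its sign at
    \<open>s\<close>.\<close>
  define N where "N x = \<sigma> * (x ^ 5 * (J' x * K x - J x * (K x * k x)))" for x
  have "N 0 \<le> N s"
  proof (rule DERIV_nonneg_imp_nondecreasing[where f = N])
    fix x :: real assume x: "0 \<le> x" "x \<le> s"
    let ?J'' = "hyp 3 (x\<^sup>2 / 4) / 2 + x\<^sup>2 / 4 * hyp 4 (x\<^sup>2 / 4)"
    have "(N has_real_derivative \<sigma> * (5 * x ^ 4 * (J' x * K x - J x * (K x * k x))
       + x ^ 5 * (?J'' * K x + J' x * (K x * k x) - (J' x * (K x * k x) + J x * (K x * k x * k x + K x * k' x))))) (at x)"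
      unfolding N_def[abs_def]
      by (rule derivative_eq_intros deriv_J deriv_J' K(2) k x refl | simp)+
    also have "\<sigma> * (5 * x ^ 4 * (J' x * K x - J x * (K x * k x))
       + x ^ 5 * (?J'' * K x + J' x * (K x * k x) - (J' x * (K x * k x) + J x * (K x * k x * k x + K x * k' x))))
       = \<sigma> * x ^ 4 * (5 * (J' x * K x - J x * K x * k x)
       + (x * ?J'') * K x - x * (J x * (K x * (k x)\<^sup>2 + K x * k' x)))"
      by (simp add: algebra_simps power2_eq_square eval_nat_numeral)
    also have "\<dots> = x ^ 4 * J x * K x * (\<sigma> * (x - 5 * k x - x * (k x)\<^sup>2 - x * k' x))"
      unfolding J_ode by (simp add: algebra_simps)
    finally show "\<exists>y. DERIV N x :> y \<and> 0 \<le> y"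
      using le[OF x(1)] K(1)[OF x(1)] J_pos[of x] x
      by (intro exI[of _ "x ^ 4 * J x * K x * (\<sigma> * (x - 5 * k x - x * (k x)\<^sup>2 - x * k' x))"] conjI)
        (auto intro!: mult_nonneg_nonneg simp: less_imp_le)
  qed (use s in simp)
  also have "N s = s ^ 5 * K s * J s * (\<sigma> * (J' s / J s - k s))"
    using J_pos[of s] by (simp add: N_def field_simps)
  finally have "0 \<le> s ^ 5 * K s * J s * (\<sigma> * (J' s / J s - k s))"
    by (simp add: N_def)
  moreover have "0 < s ^ 5 * K s * J s"
    using K(1)[of s] J_pos[of s] s by simp
  ultimately show ?thesis
    by (metis mult_pos_neg not_le)
qed

section \<open>Comparison of logarithmic derivatives and second differences\<close>

text \<open>The comparison function is exp x * P(x) powr (-\<kappa>), with logarithmic derivative 1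
  - \<kappa> P'/P. Multiplying its defect by P^2 clears denominators, so for polynomial
  \<open>P\<close> the hypothesis is a polynomial inequality.\<close>

lemma log_deriv_compare_poly:
  fixes P P' P'' :: "real \<Rightarrow> real" and \<kappa> \<sigma> s :: real
  assumes s: "0 < s"
    and P: "\<And>x. 0 \<le> x \<Longrightarrow> 0 < P x"
    and P': "\<And>x. (P has_real_derivative P' x) (at x)"
    and P'': "\<And>x. (P' has_real_derivative P'' x) (at x)"
    and le: "\<And>x. 0 \<le> x \<Longrightarrow> 0 \<le> \<sigma> * (x * (P x)\<^sup>2 - 5 * P x * (P x - \<kappa> * P' x)
               - x * (P x - \<kappa> * P' x)\<^sup>2 + \<kappa> * x * (P'' x * P x - (P' x)\<^sup>2))"
  shows "0 \<le> \<sigma> * (J' s / J s - (1 - \<kappa> * P' s / P s))"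
proof (rule log_deriv_compare[OF s])
  fix x :: real assume x: "0 \<le> x"
  note Px = P[OF x]
  show "0 < exp (x - \<kappa> * ln (P x))" by simp
  have "((\<lambda>x. x - \<kappa> * ln (P x)) has_real_derivative 1 - \<kappa> * (1 / P x * P' x)) (at x)"
    by (intro DERIV_diff DERIV_ident DERIV_cmult DERIV_chain2[OF DERIV_ln_divide P'] Px)
  from DERIV_chain2[OF DERIV_exp this]
  show "((\<lambda>x. exp (x - \<kappa> * ln (P x))) has_real_derivative
      exp (x - \<kappa> * ln (P x)) * (1 - \<kappa> * P' x / P x)) (at x)"
    by simp
  have "((\<lambda>x. 1 - \<kappa> * P' x / P x) has_real_derivative
      0 - (\<kappa> * P'' x * P x - \<kappa> * P' x * P' x) / (P x * P x)) (at x)"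
    using Px by (intro DERIV_diff DERIV_const DERIV_divide DERIV_cmult P' P'') simp
  then show "((\<lambda>x. 1 - \<kappa> * P' x / P x) has_real_derivative
      - \<kappa> * (P'' x * P x - (P' x)\<^sup>2) / (P x)\<^sup>2) (at x)"
    by (rule DERIV_cong) (use Px in \<open>simp add: field_simps power2_eq_square\<close>)
  have "\<sigma> * (x - 5 * (1 - \<kappa> * P' x / P x) - x * (1 - \<kappa> * P' x / P x)\<^sup>2 - x * (- \<kappa> * (P'' x * P x - (P' x)\<^sup>2) / (P x)\<^sup>2))
      = \<sigma> * (x * (P x)\<^sup>2 - 5 * P x * (P x - \<kappa> * P' x)
               - x * (P x - \<kappa> * P' x)\<^sup>2 + \<kappa> * x * (P'' x * P x - (P' x)\<^sup>2)) / (P x)\<^sup>2"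
    using Px by (simp add: divide_simps) (simp add: algebra_simps power2_eq_square)
  then show "0 \<le> \<sigma> * (x - 5 * (1 - \<kappa> * P' x / P x) - x * (1 - \<kappa> * P' x / P x)\<^sup>2
      - x * (- \<kappa> * (P'' x * P x - (P' x)\<^sup>2) / (P x)\<^sup>2))"
    using le[OF x] by simp
qed

text \<open>The coefficients of the two polynomials, except the constant term 7 of the cubic, are forced by the
  asymptotics \<open>J' / J = 1 - 5/(2 s) + 15/(8 s\<^sup>2) + 15/(8 s\<^sup>3) + O(s\<^sup>-\<^sup>4)\<close>; 7 is chosen to make the defect
  of constant sign.\<close>

lemma J_log_deriv_lower:
  assumes "0 < s"
  shows "1 - 5/4 * (2 * s + 3/2) / (s\<^sup>2 + 3/2 * s + 15/8) \<le> J' s / J s"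
proof -
  have "0 \<le> 1 * (J' s / J s - (1 - 5/4 * (2 * s + 3/2) / (s\<^sup>2 + 3/2 * s + 15/8)))"
  \<comment> \<open>Since J s behaves like a constant times exp s * s powr (-5/2), \<kappa> times
    the degree of P must be 5/2: hence 5/4 for the quadratic and 5/6 for the cubic below.\<close>
  proof (rule log_deriv_compare_poly[OF assms, where P'' = "\<lambda>_. 2"])
    fix x :: real assume x: "0 \<le> x"
    show "0 < x\<^sup>2 + 3/2 * x + 15/8" using x by (intro add_nonneg_pos) auto
    let ?P = "x\<^sup>2 + 3/2 * x + 15/8" and ?P' = "2 * x + 3/2"
    have "1 * (x * ?P\<^sup>2 - 5 * ?P * (?P - 5/4 * ?P') - x * (?P - 5/4 * ?P')\<^sup>2 + 5/4 * x * (2 * ?P - ?P'\<^sup>2))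
      = 945/64 * x"
      by (simp add: field_simps eval_nat_numeral)
    then show "0 \<le> 1 * (x * ?P\<^sup>2 - 5 * ?P * (?P - 5/4 * ?P') - x * (?P - 5/4 * ?P')\<^sup>2 + 5/4 * x * (2 * ?P - ?P'\<^sup>2))"
      using x by linarith
  qed (auto intro!: derivative_eq_intros)
  then show ?thesis by simp
qed

lemma J_log_deriv_upper:
  assumes "0 < s"
  shows "J' s / J s \<le> 1 - 5/6 * (3 * s\<^sup>2 + 9/2 * s + 117/32) / (s^3 + 9/4 * s\<^sup>2 + 117/32 * s + 7)"
proof -
  have "0 \<le> - 1 * (J' s / J s - (1 - 5/6 * (3 * s\<^sup>2 + 9/2 * s + 117/32) / (s^3 + 9/4 * s\<^sup>2 + 117/32 * s + 7)))"
  proof (rule log_deriv_compare_poly[OF assms, where P'' = "\<lambda>s. 6 * s + 9/2"])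
    fix x :: real assume x: "0 \<le> x"
    show "0 < x^3 + 9/4 * x\<^sup>2 + 117/32 * x + 7" using x by (intro add_nonneg_pos add_nonneg_nonneg) auto
    let ?P = "x^3 + 9/4 * x\<^sup>2 + 117/32 * x + 7" and ?P' = "3 * x\<^sup>2 + 9/2 * x + 117/32"
    have "- 1 * (x * ?P\<^sup>2 - 5 * ?P * (?P - 5/6 * ?P') - x * (?P - 5/6 * ?P')\<^sup>2 + 5/6 * x * ((6 * x + 9/2) * ?P - ?P'\<^sup>2))
      = 1375/128 * x * (x - 2)\<^sup>2 + 1925/512 * (x - 3)\<^sup>2 + 385/4096 * x + 53515/512"
      by (simp add: field_simps eval_nat_numeral)
    also have "\<dots> \<ge> 0" using x by simp
    finally show "0 \<le> - 1 * (x * ?P\<^sup>2 - 5 * ?P * (?P - 5/6 * ?P') - x * (?P - 5/6 * ?P')\<^sup>2 + 5/6 * x * ((6 * x + 9/2) * ?P - ?P'\<^sup>2))" .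
  qed (auto intro!: derivative_eq_intros)
  then show ?thesis by simp
qed

text \<open>From I_2(s) ~ exp s / sqrt (2 pi s) * (1 - 15/(8 s) + ...) with s =
  \<open>sqrt v\<close>, constants dropped. The true coefficient of 1/v is -15/16; \<open>c\<close>
  is left free so that values on either side of it give bounds in both directions.\<close>

definition \<phi> :: "real \<Rightarrow> real \<Rightarrow> real" where
  "\<phi> c v = sqrt v - 5/4 * ln v - 15 / (8 * sqrt v) + c / v"

definition \<phi>' :: "real \<Rightarrow> real \<Rightarrow> real" where
  "\<phi>' c v = 1 / (2 * sqrt v) - 5 / (4 * v) + 15 / (16 * sqrt v ^ 3) - c / v\<^sup>2"

definition \<phi>'' :: "real \<Rightarrow> real \<Rightarrow> real" where
  "\<phi>'' c v = - 1 / (4 * sqrt v ^ 3) + 5 / (4 * sqrt v ^ 4) - 45 / (32 * sqrt v ^ 5) + 2 * c / sqrt v ^ 6"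

lemma deriv_phi:
  assumes "0 < v"
  shows "(\<phi> c has_real_derivative \<phi>' c v) (at v)"
proof -
  have "((\<lambda>v. 15 / (8 * sqrt v)) has_real_derivative - (15 / 8 * (inverse (sqrt v) / 2)) / (sqrt v)\<^sup>2) (at v)"
    using assms by (auto intro!: derivative_eq_intros simp: power2_eq_square)
  moreover have "((\<lambda>v. c / v) has_real_derivative - c / v\<^sup>2) (at v)"
    using assms by (auto intro!: derivative_eq_intros simp: power2_eq_square)
  moreover have "((\<lambda>v. 5/4 * ln v) has_real_derivative 5/4 * (1 / v)) (at v)"
    using assms by (auto intro!: derivative_eq_intros)
  ultimately have "(\<phi> c has_real_derivative inverse (sqrt v) / 2 - 5/4 * (1 / v)
      - - (15 / 8 * (inverse (sqrt v) / 2)) / (sqrt v)\<^sup>2 + - c / v\<^sup>2) (at v)"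
    unfolding \<phi>_def[abs_def] by (intro DERIV_add DERIV_diff DERIV_real_sqrt[OF assms])
  then show ?thesis
    by (rule DERIV_cong) (simp add: \<phi>'_def inverse_eq_divide eval_nat_numeral)
qed

lemma deriv_phi':
  assumes "0 < v"
  shows "(\<phi>' c has_real_derivative \<phi>'' c v) (at v)"
proof -
  define s where "s = sqrt v"
  have s: "0 < s" "v = s\<^sup>2" using assms by (auto simp: s_def)
  have "((\<lambda>v. 1 / (2 * sqrt v)) has_real_derivative - (1 / 2 * (inverse s / 2)) / s\<^sup>2) (at v)"
    using assms by (auto intro!: derivative_eq_intros simp: power2_eq_square s_def)
  moreover have "((\<lambda>v. 15 / (16 * sqrt v ^ 3)) has_real_derivative - (15 / 16 * (3 * s\<^sup>2 * (inverse s / 2))) / (s ^ 3)\<^sup>2) (at v)"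
    using assms by (auto intro!: derivative_eq_intros simp: power2_eq_square s_def)
  moreover have "((\<lambda>v. 5 / (4 * v)) has_real_derivative - (5 / 4) / v\<^sup>2) (at v)"
    using assms by (auto intro!: derivative_eq_intros simp: power2_eq_square)
  moreover have "((\<lambda>v. c / v\<^sup>2) has_real_derivative - (c * (2 * v)) / (v\<^sup>2)\<^sup>2) (at v)"
    using assms by (auto intro!: derivative_eq_intros simp: power2_eq_square)
  ultimately have "(\<phi>' c has_real_derivative - (1 / 2 * (inverse s / 2)) / s\<^sup>2 - - (5 / 4) / v\<^sup>2
      + - (15 / 16 * (3 * s\<^sup>2 * (inverse s / 2))) / (s ^ 3)\<^sup>2 - - (c * (2 * v)) / (v\<^sup>2)\<^sup>2) (at v)"
    unfolding \<phi>'_def[abs_def] by (intro DERIV_add DERIV_diff)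
  also have "- (1 / 2 * (inverse s / 2)) / s\<^sup>2 - - (5 / 4) / v\<^sup>2
      + - (15 / 16 * (3 * s\<^sup>2 * (inverse s / 2))) / (s ^ 3)\<^sup>2 - - (c * (2 * v)) / (v\<^sup>2)\<^sup>2 = \<phi>'' c v"
    using s(1) unfolding \<phi>''_def s_def[symmetric] unfolding s(2)
    by (simp add: divide_simps eval_nat_numeral)
  finally show ?thesis .
qed

section \<open>The second derivative of L compared with that of \<phi>\<close>

definition L :: "real \<Rightarrow> real" where "L v = ln (hyp 2 (v / 4))"

definition L' :: "real \<Rightarrow> real" where "L' v = hyp 3 (v / 4) / (4 * hyp 2 (v / 4))"

definition L'' :: "real \<Rightarrow> real" where
  "L'' v = (hyp 4 (v / 4) * hyp 2 (v / 4) - (hyp 3 (v / 4))\<^sup>2) / (16 * (hyp 2 (v / 4))\<^sup>2)"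

lemma deriv_hyp_quarter: "((\<lambda>v. hyp n (v / 4)) has_real_derivative hyp (Suc n) (v / 4) / 4) (at v)"
  by (rule DERIV_cong, rule DERIV_chain2[OF has_field_derivative_hyp])
    (auto intro!: derivative_eq_intros)

lemma deriv_L:
  assumes "0 < v"
  shows "(L has_real_derivative L' v) (at v)"
proof -
  have "0 < hyp 2 (v / 4)" using assms by (simp add: hyp_pos)
  from DERIV_chain2[OF DERIV_ln_divide[OF this] deriv_hyp_quarter]
  show ?thesis by (simp add: L_def[abs_def] L'_def eval_nat_numeral mult.commute)
qed

lemma deriv_L':
  assumes "0 < v"
  shows "(L' has_real_derivative L'' v) (at v)"
proof -
  have pos: "0 < hyp 2 (v / 4)" using assms by (simp add: hyp_pos)
  have "((\<lambda>v. hyp 3 (v / 4) / (4 * hyp 2 (v / 4))) has_real_derivative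
      (hyp (Suc 3) (v / 4) / 4 * (4 * hyp 2 (v / 4)) - hyp 3 (v / 4) * (4 * (hyp (Suc 2) (v / 4) / 4)))
        / (4 * hyp 2 (v / 4) * (4 * hyp 2 (v / 4)))) (at v)"
    using pos by (intro DERIV_divide DERIV_cmult deriv_hyp_quarter) simp
  then show ?thesis
    by (simp add: L'_def[abs_def] L''_def power2_eq_square mult_ac flip: eval_nat_numeral)
qed

text \<open>The recurrence eliminates \<open>hyp 4\<close>, leaving a quadratic in the single
  quotient J'/J = s/2 * hyp 3 / hyp 2. Completing the square makes the dependence monotone as long
  as J'/J + 3/s is nonnegative.\<close>

lemma L''_eq:
  assumes "0 < s"
  shows "L'' (s\<^sup>2) = (1 + 9 / s\<^sup>2 - (J' s / J s + 3 / s)\<^sup>2) / (4 * s\<^sup>2)"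
proof -
  have rec: "s\<^sup>2 * hyp 4 (s\<^sup>2 / 4) = 4 * (hyp 2 (s\<^sup>2 / 4) - 3 * hyp 3 (s\<^sup>2 / 4))"
    using hyp_recurrence[of 2 "s\<^sup>2 / 4"] by simp
  have "L'' (s\<^sup>2) = (s\<^sup>2 * (hyp 4 (s\<^sup>2 / 4) * hyp 2 (s\<^sup>2 / 4) - (hyp 3 (s\<^sup>2 / 4))\<^sup>2))
                / (s\<^sup>2 * (16 * (hyp 2 (s\<^sup>2 / 4))\<^sup>2))"
    using assms by (simp add: L''_def)
  also have "\<dots> = (s\<^sup>2 * hyp 4 (s\<^sup>2 / 4) * hyp 2 (s\<^sup>2 / 4) - s\<^sup>2 * (hyp 3 (s\<^sup>2 / 4))\<^sup>2)
                / (16 * s\<^sup>2 * (hyp 2 (s\<^sup>2 / 4))\<^sup>2)"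
    by (simp add: algebra_simps)
  also have "\<dots> = (1 + 9 / s\<^sup>2 - (J' s / J s + 3 / s)\<^sup>2) / (4 * s\<^sup>2)"
    unfolding rec using assms hyp_pos[of "s\<^sup>2/4" 2]
    by (simp add: J_def J'_def divide_simps) (simp add: algebra_simps eval_nat_numeral)
  finally show ?thesis .
qed

text \<open>Brought into the shape of \<open>L''_eq\<close>, so that comparing the second
  derivatives amounts to comparing the subtracted terms.\<close>

lemma \<phi>''_eq:
  assumes "0 < s"
  shows "\<phi>'' c (s\<^sup>2) = (1 + 9 / s\<^sup>2 - (s^4 + s^3 + 4 * s\<^sup>2 + 45/8 * s - 8 * c) / s^4) / (4 * s\<^sup>2)"
  using assms by (simp add: \<phi>''_def divide_simps) (simp add: algebra_simps eval_nat_numeral)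

text \<open>\<open>L''\<close> decreases in J'/J, so the lower bound of the quotient is the one to
  use. With c = 1 the inequality cleared of denominators has only positive coefficients.\<close>

lemma L''_upper:
  assumes "0 < v"
  shows "L'' v \<le> \<phi>'' 1 v"
proof -
  define s where "s = sqrt v"
  have s: "0 < s" "v = s\<^sup>2" using assms by (auto simp: s_def)
  let ?P = "s\<^sup>2 + 3/2 * s + 15/8" and ?Q = "s^3 + 2 * s\<^sup>2 + 9/2 * s + 45/8"
  have pos: "0 < ?P" "0 < ?Q" using s by (auto intro!: add_pos_pos)
  have "1 - 5/4 * (2 * s + 3/2) / ?P + 3 / s = ?Q / (s * ?P)"
    using s pos by (simp add: divide_simps) (simp add: algebra_simps eval_nat_numeral)
  then have "?Q / (s * ?P) \<le> J' s / J s + 3 / s"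
    using J_log_deriv_lower[OF s(1)] by linarith
  then have "(?Q / (s * ?P))\<^sup>2 \<le> (J' s / J s + 3 / s)\<^sup>2"
    using pos s by (intro power_mono) auto
  moreover have "(s^4 + s^3 + 4 * s\<^sup>2 + 45/8 * s - 8 * 1) / s^4 \<le> (?Q / (s * ?P))\<^sup>2"
  proof -
    have "s\<^sup>2 * ?Q\<^sup>2 - ?P\<^sup>2 * (s^4 + s^3 + 4 * s\<^sup>2 + 45/8 * s - 8 * 1)
        = 225/8 + 12915/512 * s + 543/16 * s\<^sup>2 + 951/64 * s^3 + 47/64 * s^4"
      by (simp add: field_simps eval_nat_numeral)
    also have "\<dots> \<ge> 0" using s by simp
    finally have le: "?P\<^sup>2 * (s^4 + s^3 + 4 * s\<^sup>2 + 45/8 * s - 8 * 1) \<le> s\<^sup>2 * ?Q\<^sup>2"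
      by simp
    show ?thesis
      using divide_right_mono[OF le, of "s^4 * ?P\<^sup>2"] pos s(1)
      by (simp add: power_divide power_mult_distrib eval_nat_numeral mult_ac)
  qed
  ultimately have "(s^4 + s^3 + 4 * s\<^sup>2 + 45/8 * s - 8 * 1) / s^4 \<le> (J' s / J s + 3 / s)\<^sup>2"
    by linarith
  then show ?thesis
    unfolding s(2) L''_eq[OF s(1)] \<phi>''_eq[OF s(1)] using s(1) by (intro divide_right_mono) auto
qed

lemma L''_lower:
  assumes "0 < v"
  shows "\<phi>'' (- 5/2) v \<le> L'' v"
proof -
  define s where "s = sqrt v"
  have s: "0 < s" "v = s\<^sup>2" using assms by (auto simp: s_def)
  let ?P = "s^3 + 9/4 * s\<^sup>2 + 117/32 * s + 7"
  let ?Q = "s^4 + 11/4 * s^3 + 213/32 * s\<^sup>2 + 955/64 * s + 21"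
  have pos: "0 < ?P" "0 < ?Q" using s by (auto intro!: add_pos_pos)
  have "1 - 5/6 * (3 * s\<^sup>2 + 9/2 * s + 117/32) / ?P + 3 / s = ?Q / (s * ?P)"
    using s pos by (simp add: divide_simps) (simp add: algebra_simps eval_nat_numeral)
  then have "J' s / J s + 3 / s \<le> ?Q / (s * ?P)"
    using J_log_deriv_upper[OF s(1)] by linarith
  \<comment> \<open>Squaring requires the smaller side to be nonnegative; here that side is the
    unknown quotient itself.\<close>
  moreover have "0 < J' s / J s"
    using J_pos[of s] hyp_pos[of "s\<^sup>2/4" 3] s by (simp add: J'_def)
  ultimately have "(J' s / J s + 3 / s)\<^sup>2 \<le> (?Q / (s * ?P))\<^sup>2"
    using pos s by (intro power_mono) auto
  moreover have "(?Q / (s * ?P))\<^sup>2 \<le> (s^4 + s^3 + 4 * s\<^sup>2 + 45/8 * s - 8 * (- 5/2)) / s^4"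
  proof -
    have "?P\<^sup>2 * (s^4 + s^3 + 4 * s\<^sup>2 + 45/8 * s - 8 * (- 5/2)) - s\<^sup>2 * ?Q\<^sup>2
        = 980 + 10395/8 * s + 240715/256 * s\<^sup>2 + 4001605/8192 * s^3 + 803775/4096 * s^4
           + 32425/512 * s^5 + 225/128 * s^6"
      by (simp add: field_simps eval_nat_numeral)
    also have "\<dots> \<ge> 0" using s by simp
    finally have le: "s\<^sup>2 * ?Q\<^sup>2 \<le> ?P\<^sup>2 * (s^4 + s^3 + 4 * s\<^sup>2 + 45/8 * s - 8 * (- 5/2))"
      by simp
    show ?thesis
      using divide_right_mono[OF le, of "s^4 * ?P\<^sup>2"] pos s(1)
      by (simp add: power_divide power_mult_distrib eval_nat_numeral mult_ac)
  qed
  ultimately have "(J' s / J s + 3 / s)\<^sup>2 \<le> (s^4 + s^3 + 4 * s\<^sup>2 + 45/8 * s - 8 * (- 5/2)) / s^4"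
    by linarith
  then show ?thesis
    unfolding s(2) L''_eq[OF s(1)] \<phi>''_eq[OF s(1)] using s(1) by (intro divide_right_mono) auto
qed

section \<open>Second differences from convexity\<close>

lemma second_difference_nonneg:
  fixes f f' f'' :: "real \<Rightarrow> real"
  assumes "0 < d" "d < v"
    and f': "\<And>x. 0 < x \<Longrightarrow> (f has_real_derivative f' x) (at x)"
    and f'': "\<And>x. 0 < x \<Longrightarrow> (f' has_real_derivative f'' x) (at x)"
    and nonneg: "\<And>x. 0 < x \<Longrightarrow> 0 \<le> f'' x"
  shows "2 * f v \<le> f (v - d) + f (v + d)"
proof -
  have "convex_on {0<..} f"
    by (rule f''_ge0_imp_convex[where f' = f' and f'' = f'']) (use f' f'' nonneg in auto)
  then have "f ((1 - 1/2) *\<^sub>R (v - d) + (1/2) *\<^sub>R (v + d)) \<le> (1 - 1/2) * f (v - d) + 1/2 * f (v + d)"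
    by (rule convex_onD) (use assms(1,2) in auto)
  then show ?thesis by (simp add: field_simps)
qed

text \<open>Both \<open>\<phi> 1 - L\<close> and \<open>L - \<phi> (- 5/2)\<close> are convex on the
  positive half-line, and v is the midpoint of v - d and v + d.\<close>

lemma second_difference_L:
  assumes "0 < d" "d < v"
  shows "L (v - d) + L (v + d) - 2 * L v \<le> \<phi> 1 (v - d) + \<phi> 1 (v + d) - 2 * \<phi> 1 v"
    and "\<phi> (- 5/2) (v - d) + \<phi> (- 5/2) (v + d) - 2 * \<phi> (- 5/2) v \<le> L (v - d) + L (v + d) - 2 * L v"
proof -
  have "2 * (\<phi> 1 v - L v) \<le> (\<phi> 1 (v - d) - L (v - d)) + (\<phi> 1 (v + d) - L (v + d))"
    by (rule second_difference_nonneg[OF assms, where f' = "\<lambda>v. \<phi>' 1 v - L' v" and f'' = "\<lambda>v. \<phi>'' 1 v - L'' v"])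
      (auto intro!: DERIV_diff deriv_phi deriv_phi' deriv_L deriv_L' simp: L''_upper)
  then show "L (v - d) + L (v + d) - 2 * L v \<le> \<phi> 1 (v - d) + \<phi> 1 (v + d) - 2 * \<phi> 1 v" by simp
  have "2 * (L v - \<phi> (- 5/2) v) \<le> (L (v - d) - \<phi> (- 5/2) (v - d)) + (L (v + d) - \<phi> (- 5/2) (v + d))"
    by (rule second_difference_nonneg[OF assms, where f' = "\<lambda>v. L' v - \<phi>' (- 5/2) v" and f'' = "\<lambda>v. L'' v - \<phi>'' (- 5/2) v"])
      (auto intro!: DERIV_diff deriv_phi deriv_phi' deriv_L deriv_L' simp: L''_lower[simplified])
  then show "\<phi> (- 5/2) (v - d) + \<phi> (- 5/2) (v + d) - 2 * \<phi> (- 5/2) v \<le> L (v - d) + L (v + d) - 2 * L v" by simp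
qed

section \<open>Elementary estimates of square roots, exponentials and logarithms\<close>

text \<open>With step s^2 t every term of \<phi> splits into a part in \<open>s\<close> and a part
  in \<open>t\<close>; the contributions of \<open>ln (s\<^sup>2)\<close> cancel.\<close>

lemma phi_second_difference:
  assumes s: "0 < s" and t: "0 < t" "t < 1"
  shows "\<phi> c (s\<^sup>2 - s\<^sup>2 * t) + \<phi> c (s\<^sup>2 + s\<^sup>2 * t) - 2 * \<phi> c (s\<^sup>2)
    = s * (sqrt (1 + t) + sqrt (1 - t) - 2) - 5/4 * ln (1 - t\<^sup>2)
      - 15 / (8 * s) * (1 / sqrt (1 + t) + 1 / sqrt (1 - t) - 2) + c * (2 * t\<^sup>2 / (s\<^sup>2 * (1 - t\<^sup>2)))"
proof -
  have fac: "s\<^sup>2 - s\<^sup>2 * t = s\<^sup>2 * (1 - t)" "s\<^sup>2 + s\<^sup>2 * t = s\<^sup>2 * (1 + t)"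
    by (simp_all add: algebra_simps)
  have t2: "1 - t\<^sup>2 = (1 - t) * (1 + t)"
    by (simp add: algebra_simps power2_eq_square)
  have c_eq: "c * (2 * t\<^sup>2 / (s\<^sup>2 * (1 - t\<^sup>2))) = c / (s\<^sup>2 * (1 - t)) + c / (s\<^sup>2 * (1 + t)) - 2 * (c / s\<^sup>2)"
    unfolding t2 using s t by (simp add: divide_simps) (simp add: algebra_simps power2_eq_square)
  have inv_eq: "15 / (8 * s) * (1 / sqrt (1 + t) + 1 / sqrt (1 - t) - 2)
      = 15 / (8 * (s * sqrt (1 - t))) + 15 / (8 * (s * sqrt (1 + t))) - 2 * (15 / (8 * s))"
    using s t by (simp add: field_simps)
  have sqrt_eq: "sqrt (s\<^sup>2 * (1 - t)) = s * sqrt (1 - t)" "sqrt (s\<^sup>2 * (1 + t)) = s * sqrt (1 + t)" "sqrt (s\<^sup>2) = s"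
    using s by (simp_all add: real_sqrt_mult)
  have ln_eq: "ln (s\<^sup>2 * (1 - t)) = ln (s\<^sup>2) + ln (1 - t)" "ln (s\<^sup>2 * (1 + t)) = ln (s\<^sup>2) + ln (1 + t)"
      "ln (1 - t\<^sup>2) = ln (1 - t) + ln (1 + t)"
    unfolding t2 using s t by (simp_all add: ln_mult)
  show ?thesis
    unfolding fac \<phi>_def sqrt_eq ln_eq c_eq inv_eq by (simp add: algebra_simps)
qed

text \<open>Squaring leaves the single root of 1 - t^2, which turns the estimates below into
  polynomial inequalities.\<close>

lemma sum_sqrt_sq:
  fixes t :: real
  assumes "0 < t" "t < 1"
  shows "(sqrt (1 + t) + sqrt (1 - t))\<^sup>2 = 2 + 2 * sqrt (1 - t\<^sup>2)"
proof -
  have "sqrt (1 + t) * sqrt (1 - t) = sqrt (1 - t\<^sup>2)"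
    by (simp add: algebra_simps power2_eq_square flip: real_sqrt_mult)
  then show ?thesis using assms by (simp add: power2_sum)
qed

text \<open>In the application t = 24 / (24 n - 2 k - 2), whose largest value 4/7 occurs at n = k =
  2.\<close>

lemma power2_le_sixteen_49ths:
  fixes t :: real
  assumes "0 < t" "t \<le> 4/7"
  shows "t\<^sup>2 \<le> 16/49"
  using power_mono[of t "4/7" 2] assms by (simp add: power_divide)

lemma sum_sqrt_upper:
  fixes t :: real
  assumes "0 < t" "t < 1"
  shows "sqrt (1 + t) + sqrt (1 - t) - 2 \<le> - t\<^sup>2 / 4"
proof -
  have t2: "t\<^sup>2 < 1" using assms by (simp add: power_less_one_iff)
  have "sqrt (1 - t\<^sup>2) \<le> 1 - t\<^sup>2 / 2"
    by (rule real_le_lsqrt) (use t2 in \<open>auto simp: power2_diff\<close>)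
  moreover have "(2 - t\<^sup>2 / 4)\<^sup>2 = 4 - t\<^sup>2 + (t\<^sup>2 / 4)\<^sup>2"
    by (simp add: power2_diff)
  ultimately have "(sqrt (1 + t) + sqrt (1 - t))\<^sup>2 \<le> (2 - t\<^sup>2 / 4)\<^sup>2"
    unfolding sum_sqrt_sq[OF assms] using zero_le_power2[of "t\<^sup>2 / 4"] by linarith
  then have "sqrt (1 + t) + sqrt (1 - t) \<le> 2 - t\<^sup>2 / 4"
    by (rule power2_le_imp_le) (use t2 in simp)
  then show ?thesis by simp
qed

lemma sum_sqrt_lower:
  fixes t :: real
  assumes "0 < t" "t \<le> 4/7"
  shows "- t\<^sup>2 / 4 - 5/32 * t^4 \<le> sqrt (1 + t) + sqrt (1 - t) - 2"
proof -
  define e where "e = t\<^sup>2"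
  have e: "0 \<le> e" "e \<le> 16/49" "t^4 = e\<^sup>2"
    using power2_le_sixteen_49ths[OF assms] by (simp_all add: e_def flip: power_mult)
  \<comment> \<open>\<open>?w\<close> is chosen so that 2 + 2 * ?w is exactly the square of 2 - e/4
    - 5/32 * e^2. The coefficient 5/32 is that of the s t^4 term in the lower bound to be proved,
    twice the Taylor coefficient 5/64.\<close>
  let ?w = "1 - e/2 - 9/32 * e\<^sup>2 + 5/128 * e^3 + 25/2048 * e^4"
  have "1 - e - ?w\<^sup>2 = e\<^sup>2 * (5/16 - 23/64 * e - 33/512 * e\<^sup>2 + e^3 * (35/1024 + 175/32768 * e - 125/131072 * e\<^sup>2 - 625/4194304 * e^3))"
    by (simp add: field_simps eval_nat_numeral)
  also have "0 \<le> \<dots>"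
  proof (intro mult_nonneg_nonneg)
    have "e\<^sup>2 \<le> 1" "e^3 \<le> 1" using e by (simp_all add: power_le_one)
    with e show "0 \<le> 5/16 - 23/64 * e - 33/512 * e\<^sup>2 + e^3 * (35/1024 + 175/32768 * e - 125/131072 * e\<^sup>2 - 625/4194304 * e^3)"
      by (intro add_nonneg_nonneg mult_nonneg_nonneg) auto
  qed (use e in auto)
  finally have "?w \<le> sqrt (1 - e)"
    by (intro real_le_rsqrt) simp
  then have "(2 - e / 4 - 5/32 * e\<^sup>2)\<^sup>2 \<le> 2 + 2 * sqrt (1 - e)"
    by (simp add: field_simps eval_nat_numeral)
  then have "(2 - e / 4 - 5/32 * e\<^sup>2)\<^sup>2 \<le> (sqrt (1 + t) + sqrt (1 - t))\<^sup>2"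
    using sum_sqrt_sq[of t] assms by (simp add: e_def)
  then have "2 - e / 4 - 5/32 * e\<^sup>2 \<le> sqrt (1 + t) + sqrt (1 - t)"
    by (rule power2_le_imp_le) (use assms in simp)
  then show ?thesis
    unfolding e(3) e_def[symmetric] by simp
qed

lemma sum_inv_sqrt_sq:
  fixes t :: real
  assumes "0 < t" "t < 1"
  shows "(1 / sqrt (1 + t) + 1 / sqrt (1 - t))\<^sup>2 = (2 + 2 * sqrt (1 - t\<^sup>2)) / (sqrt (1 - t\<^sup>2))\<^sup>2"
proof -
  have "sqrt (1 - t\<^sup>2) = sqrt (1 + t) * sqrt (1 - t)"
    by (simp add: algebra_simps power2_eq_square flip: real_sqrt_mult)
  moreover have "1 / sqrt (1 + t) + 1 / sqrt (1 - t) = (sqrt (1 + t) + sqrt (1 - t)) / (sqrt (1 + t) * sqrt (1 - t))"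
    using assms by (simp add: field_simps)
  ultimately show ?thesis
    using sum_sqrt_sq[OF assms] by (simp add: power_divide)
qed

lemma sum_inv_sqrt_lower:
  fixes t :: real
  assumes "0 < t" "t < 1"
  shows "3/4 * t\<^sup>2 \<le> 1 / sqrt (1 + t) + 1 / sqrt (1 - t) - 2"
proof -
  define r where "r = sqrt (1 - t\<^sup>2)"
  have t2: "t\<^sup>2 < 1" using assms by (simp add: power_less_one_iff)
  have r: "0 < r" "r \<le> 1" "t\<^sup>2 = 1 - r\<^sup>2" using t2 by (auto simp: r_def)
  \<comment> \<open>As 3/4 is the exact Taylor coefficient, the two sides differ by O(t^4), which
    appears as the double zero at r = 1.\<close>
  have "16 * (2 + 2 * r - (2 + 3/4 * t\<^sup>2)\<^sup>2 * r\<^sup>2) = (1 - r)\<^sup>2 * (32 + 96 * r + 9 * r\<^sup>2 * (1 - r\<^sup>2) + 18 * r\<^sup>2 * (1 - r) + 12 * r\<^sup>2)"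
    unfolding r(3) by (simp add: field_simps eval_nat_numeral)
  also have "\<dots> \<ge> 0"
    using r power_le_one[of r 2] by (intro mult_nonneg_nonneg add_nonneg_nonneg) auto
  finally have "(2 + 3/4 * t\<^sup>2)\<^sup>2 \<le> (2 + 2 * r) / r\<^sup>2"
    using r(1) by (simp add: field_simps)
  then have "(2 + 3/4 * t\<^sup>2)\<^sup>2 \<le> (1 / sqrt (1 + t) + 1 / sqrt (1 - t))\<^sup>2"
    using sum_inv_sqrt_sq[OF assms] by (simp add: r_def)
  then have "2 + 3/4 * t\<^sup>2 \<le> 1 / sqrt (1 + t) + 1 / sqrt (1 - t)"
    by (rule power2_le_imp_le) (use assms in simp)
  then show ?thesis by simp
qed

lemma sum_inv_sqrt_upper:
  fixes t :: real
  assumes "0 < t" "t \<le> 4/7"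
  shows "1 / sqrt (1 + t) + 1 / sqrt (1 - t) - 2 \<le> 3/4 * t\<^sup>2 + 4/5 * t^4"
proof -
  define r where "r = sqrt (1 - t\<^sup>2)"
  define y where "y = 1 - r"
  have t1: "t < 1" using assms by simp
  have t2: "t\<^sup>2 \<le> 16/49" by (rule power2_le_sixteen_49ths[OF assms])
  have r: "0 < r" "r \<le> 1" "t\<^sup>2 = 1 - r\<^sup>2" using t2 by (auto simp: r_def)
  have t4: "t^4 = (1 - r\<^sup>2)\<^sup>2" by (simp flip: r(3) power_mult)
  have "41/50 \<le> r"
    unfolding r_def by (rule real_le_rsqrt) (use t2 in \<open>simp add: power2_eq_square\<close>)
  then have y: "0 \<le> y" "y \<le> 9/50" "r = 1 - y" using r by (auto simp: y_def)
  \<comment> \<open>Tangent of y^2 at the endpoint 9/50. The multiplier 96621/5000 used next is the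
    value, hence the minimum on the range, of 9021/400 - 3587/200 * y at that endpoint.\<close>
  have "81/2500 + 9/25 * (y - 9/50) \<le> y\<^sup>2"
    using zero_le_power2[of "y - 9/50"] unfolding power2_eq_square by (simp add: algebra_simps)
  from mult_left_mono[OF this, of "96621/5000"]
  have "0 \<le> 81/20 - 471/20 * y + 96621/5000 * y\<^sup>2"
    using y(1,2) by (simp add: algebra_simps)
  also have "\<dots> \<le> 81/20 - 471/20 * y + (9021/400 - 3587/200 * y) * y\<^sup>2"
    using y by (intro add_left_mono mult_right_mono) auto
  finally have quad: "0 \<le> 81/20 - 471/20 * y + (9021/400 - 3587/200 * y) * y\<^sup>2" .
  have "r\<^sup>2 * (2 + (3/4 * t\<^sup>2 + 4/5 * t^4))\<^sup>2 - (2 + 2 * r)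
      = y\<^sup>2 * ((81/20 - 471/20 * y + (9021/400 - 3587/200 * y) * y\<^sup>2)
         + (y^4 * (16129/400 - 1168/25 * y) + y^6 * (626/25 - 32/5 * y) + 16/25 * y^8))"
    unfolding t4 r(3) unfolding y(3) by (simp add: field_simps eval_nat_numeral)
  also have "0 \<le> \<dots>"
    using y by (intro mult_nonneg_nonneg add_nonneg_nonneg[OF quad] add_nonneg_nonneg) auto
  finally have "(2 + 2 * r) / r\<^sup>2 \<le> (2 + (3/4 * t\<^sup>2 + 4/5 * t^4))\<^sup>2"
    using r(1) by (simp add: field_simps)
  then have "(1 / sqrt (1 + t) + 1 / sqrt (1 - t))\<^sup>2 \<le> (2 + (3/4 * t\<^sup>2 + 4/5 * t^4))\<^sup>2"
    using sum_inv_sqrt_sq[OF assms(1) t1] by (simp add: r_def)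
  then have "1 / sqrt (1 + t) + 1 / sqrt (1 - t) \<le> 2 + (3/4 * t\<^sup>2 + 4/5 * t^4)"
    by (rule power2_le_imp_le) (use assms in simp)
  then show ?thesis by simp
qed

section \<open>Bounds for exp (-x) and (1 - e) powr (-5/4)\<close>

lemma exp_minus_bounds:
  fixes x :: real
  assumes "0 \<le> x"
  shows "exp (- x) \<le> 1 - x + x\<^sup>2 / 2" and "1 - x + x\<^sup>2 / 2 - x^3 / 6 \<le> exp (- x)"
proof -
  \<comment> \<open>The Lagrange remainder has the sign of (-x)^3 here and of (-x)^4 below.\<close>
  obtain u where "exp (- x) = (\<Sum>m<3. (- x) ^ m / fact m) + exp u / fact 3 * (- x) ^ 3"
    using Maclaurin_exp_le[of "- x" 3] by blast
  then show "exp (- x) \<le> 1 - x + x\<^sup>2 / 2"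
    using assms by (simp add: eval_nat_numeral)
  obtain u where "exp (- x) = (\<Sum>m<4. (- x) ^ m / fact m) + exp u / fact 4 * (- x) ^ 4"
    using Maclaurin_exp_le[of "- x" 4] by blast
  then show "1 - x + x\<^sup>2 / 2 - x^3 / 6 \<le> exp (- x)"
    using assms by (simp add: eval_nat_numeral)
qed

text \<open>\<open>B\<close> agrees with the Taylor series of (1 - e) powr (-5/4) up to e^2, so the
  derivative starts with e^2. Its sign is that of 12 \<beta> - 585/32 - 17 \<beta> e: negative for
  \<beta> = 0, and nonnegative up to e = 16/49 for \<beta> = 71/25.\<close>

lemma deriv_ln_cubic:
  fixes \<beta> e :: real
  assumes "0 \<le> \<beta>" "0 \<le> e" "e < 1"
  defines "B \<equiv> \<lambda>e. 1 + 5/4 * e + 45/32 * e\<^sup>2 + \<beta> * e^3"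
  shows "((\<lambda>e. ln (B e) + 5/4 * ln (1 - e)) has_real_derivative
     e\<^sup>2 * (12 * \<beta> - 585/32 - 17 * \<beta> * e) / (4 * (1 - e) * B e)) (at e)" and "0 < B e"
proof -
  show B: "0 < B e" using assms(1,2) unfolding B_def by (intro add_pos_nonneg) auto
  have "(B has_real_derivative (5/4 + 45/16 * e + 3 * \<beta> * e\<^sup>2)) (at e)"
    unfolding B_def by (auto intro!: derivative_eq_intros)
  from DERIV_chain2[OF DERIV_ln_divide[OF B] this]
  have "((\<lambda>e. ln (B e)) has_real_derivative 1 / B e * (5/4 + 45/16 * e + 3 * \<beta> * e\<^sup>2)) (at e)" .
  moreover have "((\<lambda>e. ln (1 - e)) has_real_derivative 1 / (1 - e) * (0 - 1)) (at e)"
    using assms(3) by (intro DERIV_chain2[OF DERIV_ln_divide] DERIV_diff DERIV_const DERIV_ident) simp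
  ultimately have "((\<lambda>e. ln (B e) + 5/4 * ln (1 - e)) has_real_derivative
      1 / B e * (5/4 + 45/16 * e + 3 * \<beta> * e\<^sup>2) + 5/4 * (1 / (1 - e) * (0 - 1))) (at e)"
    by (intro DERIV_add DERIV_cmult)
  moreover have "1 / B e * (5/4 + 45/16 * e + 3 * \<beta> * e\<^sup>2) + 5/4 * (1 / (1 - e) * (0 - 1))
      = (4 * (1 - e) * (5/4 + 45/16 * e + 3 * \<beta> * e\<^sup>2) - 5 * B e) / (4 * (1 - e) * B e)"
    using B assms(3) by (simp add: field_simps)
  moreover have "4 * (1 - e) * (5/4 + 45/16 * e + 3 * \<beta> * e\<^sup>2) - 5 * B e = e\<^sup>2 * (12 * \<beta> - 585/32 - 17 * \<beta> * e)"
    unfolding B_def by (simp add: field_simps eval_nat_numeral)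
  ultimately show "((\<lambda>e. ln (B e) + 5/4 * ln (1 - e)) has_real_derivative
     e\<^sup>2 * (12 * \<beta> - 585/32 - 17 * \<beta> * e) / (4 * (1 - e) * B e)) (at e)" by simp
qed

lemma exp_ln_one_minus_upper:
  fixes e :: real
  assumes e: "0 \<le> e" "e \<le> 16/49"
  shows "exp (- 5/4 * ln (1 - e)) \<le> 1 + 5/4 * e + 45/32 * e\<^sup>2 + 71/25 * e^3"
proof -
  let ?B = "\<lambda>e::real. 1 + 5/4 * e + 45/32 * e\<^sup>2 + 71/25 * e^3"
  have "ln (?B 0) + 5/4 * ln (1 - 0) \<le> ln (?B e) + 5/4 * ln (1 - e)"
  proof (rule DERIV_nonneg_imp_nondecreasing[OF e(1)])
    fix x :: real assume x: "0 \<le> x" "x \<le> e"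
    have "0 \<le> x\<^sup>2 * (12 * (71/25) - 585/32 - 17 * (71/25) * x) / (4 * (1 - x) * ?B x)"
      using x e deriv_ln_cubic(2)[of "71/25" x] by (intro divide_nonneg_nonneg mult_nonneg_nonneg) auto
    with deriv_ln_cubic(1)[of "71/25" x] x e
    show "\<exists>y. ((\<lambda>e. ln (?B e) + 5/4 * ln (1 - e)) has_real_derivative y) (at x) \<and> 0 \<le> y"
      by fastforce
  qed
  then have "- 5/4 * ln (1 - e) \<le> ln (?B e)" by simp
  then show ?thesis
    using deriv_ln_cubic(2)[of "71/25" e] e by (simp add: ln_ge_iff)
qed

lemma exp_ln_one_minus_lower:
  fixes e :: real
  assumes e: "0 \<le> e" "e < 1"
  shows "1 + 5/4 * e + 45/32 * e\<^sup>2 \<le> exp (- 5/4 * ln (1 - e))"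
proof -
  let ?B = "\<lambda>e::real. 1 + 5/4 * e + 45/32 * e\<^sup>2 + 0 * e^3"
  have "ln (?B e) + 5/4 * ln (1 - e) \<le> ln (?B 0) + 5/4 * ln (1 - 0)"
  proof (rule DERIV_nonpos_imp_nonincreasing[OF e(1)])
    fix x :: real assume x: "0 \<le> x" "x \<le> e"
    have "x\<^sup>2 * (12 * 0 - 585/32 - 17 * 0 * x) / (4 * (1 - x) * ?B x) \<le> 0"
      using x e deriv_ln_cubic(2)[of 0 x] by (intro divide_nonpos_nonneg mult_nonneg_nonneg) auto
    with deriv_ln_cubic(1)[of 0 x] x e
    show "\<exists>y. ((\<lambda>e. ln (?B e) + 5/4 * ln (1 - e)) has_real_derivative y) (at x) \<and> y \<le> 0"
      by fastforce
  qed
  then have le: "ln (?B e) \<le> - 5/4 * ln (1 - e)" by simp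
  have "?B e = exp (ln (?B e))"
    using deriv_ln_cubic(2)[of 0 e] e by simp
  also have "\<dots> \<le> exp (- 5/4 * ln (1 - e))"
    using le by (simp only: exp_le_cancel_iff)
  finally show ?thesis by simp
qed

section \<open>The reduced inequality\<close>

text \<open>Here \<open>a = s t\<^sup>2 / 4\<close> and \<open>D = s\<^sup>2 t\<close>, so that \<open>s\<close> is eliminated: \<open>t\<^sup>2 / s = 4 a t / D\<close> and
  \<open>1 / s\<^sup>6 = u / D\<^sup>3\<close>.\<close>

locale reduced =
  fixes a t D u :: real
  assumes t: "0 < t" "t \<le> 4/7" and D: "153/10 \<le> D" "D \<le> 158/10" and a: "0 < a" and a2: "16 * a\<^sup>2 = D * u"
    and u: "u = t^3"
begin

lemma u_bounds: "0 < u" "u \<le> 64/343"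
  using power_mono[of t "4/7" 3] t by (auto simp: u power_divide)

lemma t2: "t\<^sup>2 \<le> 16/49"
  by (rule power2_le_sixteen_49ths[OF t])

text \<open>Cubic errors in t are comparable to a^2; this is what lets the quadratic term of exp
  (-a) pay for them.\<close>

lemma Du: "153/10 * u \<le> 16 * a\<^sup>2" "16 * a\<^sup>2 \<le> 158/10 * u"
  unfolding a2 using D u_bounds by (auto intro: mult_right_mono)

lemma a_le: "a \<le> 43/100"
proof (rule power2_le_imp_le)
  show "a\<^sup>2 \<le> (43/100)\<^sup>2"
    using Du u_bounds by (simp add: power2_eq_square)
qed simp

lemma at_div_D: "0 \<le> a * t / D" "a * t / D \<le> 20/1071 * 2 * a"
proof -
  show "0 \<le> a * t / D" using a t D by simp
  have "a * t / D \<le> a * (4/7) / (153/10)"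
    using a t D by (intro frac_le mult_left_mono) auto
  then show "a * t / D \<le> 20/1071 * 2 * a" by simp
qed

lemma u_div_D: "2 * u / (D * (1 - t\<^sup>2)) \<le> 1941/10000 * u" "0 \<le> 2 * u / (D * (1 - t\<^sup>2))"
proof -
  have "153/10 * (33/49) \<le> D * (1 - t\<^sup>2)"
    using D t2 by (intro mult_mono) auto
  then have "2 * u / (D * (1 - t\<^sup>2)) \<le> 2 * u / (153/10 * (33/49))"
    using u_bounds by (intro divide_left_mono) auto
  then show "2 * u / (D * (1 - t\<^sup>2)) \<le> 1941/10000 * u" using u_bounds by simp
  show "0 \<le> 2 * u / (D * (1 - t\<^sup>2))" using u_bounds D t2 by simp
qed

text \<open>Passes to the coefficient 27/16 of the target at the price of a relative error 6/25 *
  u.\<close>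

lemma cubic_le: "1 + 5/4 * t\<^sup>2 + 45/32 * (t\<^sup>2)\<^sup>2 + 71/25 * (t\<^sup>2)^3
    \<le> (1 + 5/4 * t\<^sup>2 + 27/16 * t^4) * (1 + 6/25 * u)"
proof -
  define w where "w = 4/7 - t"
  have w: "0 \<le> w" "t = 4/7 - w" using t by (auto simp: w_def)
  have "(1 + 5/4 * t\<^sup>2 + 27/16 * t^4) * (1 + 6/25 * u) - (1 + 5/4 * t\<^sup>2 + 45/32 * (t\<^sup>2)\<^sup>2 + 71/25 * (t\<^sup>2)^3)
    = t^3 * (6/25 + 9/32 * t + 3/10 * t\<^sup>2 - 71/25 * t^3 + 81/200 * t^4)"
    unfolding u by (simp add: field_simps eval_nat_numeral)
  \<comment> \<open>Bernstein form on [0, 4/7] in t and w: the positive coefficients show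
    nonnegativity.\<close>
  also have "6/25 + 9/32 * t + 3/10 * t\<^sup>2 - 71/25 * t^3 + 81/200 * t^4
    = 7203/3200 * w^4 + 538167/51200 * t * w^3 + 970053/51200 * t\<^sup>2 * w\<^sup>2 + 532133/51200 * t^3 * w + 1147/10240 * t^4"
    unfolding w(2) by (simp add: field_simps eval_nat_numeral)
  also have "0 \<le> t^3 * \<dots>"
    using t w(1) by (intro mult_nonneg_nonneg add_nonneg_nonneg) auto
  finally show ?thesis by simp
qed

text \<open>The target contains a^2 where exp (-a) needs only a^2/2. The spare a^2/2 is at least
  4758/10000 * u, which covers the relative errors of the other two exponential factors.\<close>

lemma upper:
  "exp (- a) * exp (- 5/4 * ln (1 - t\<^sup>2)) * exp (- 45/8 * (a * t / D) + 2 * u / (D * (1 - t\<^sup>2)))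
    < (1 + 5/4 * t\<^sup>2 + 27/16 * t^4) * (1 - a + a\<^sup>2) * (1 - 45/8 * (a * t / D) + 292 * u / D^3)"
proof -
  define b where "b = 45/8 * (a * t / D)"
  define g where "g = 2 * u / (D * (1 - t\<^sup>2))"
  let ?A = "1 + 5/4 * t\<^sup>2 + 27/16 * t^4"
  have b: "0 \<le> b" "b \<le> 904/10000"
    using at_div_D a_le by (auto simp: b_def)
  have g: "0 \<le> g" "g \<le> 1941/10000 * u" "g \<le> 363/10000"
    using u_div_D u_bounds by (auto simp: g_def)
  have b2: "b\<^sup>2 \<le> 423/10000 * u"
  proof -
    have "b\<^sup>2 = (45/8)\<^sup>2 / 16 * (16 * a\<^sup>2) * t\<^sup>2 / D\<^sup>2"
      by (simp add: b_def power_divide power_mult_distrib)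
    also have "\<dots> = 2025/1024 * u * (t\<^sup>2 / D)"
      unfolding a2 using D by (simp add: power2_eq_square)
    also have "\<dots> \<le> 2025/1024 * u * ((16/49) / (153/10))"
      using u_bounds t2 D by (intro mult_left_mono frac_le) auto
    also have "\<dots> \<le> 423/10000 * u" using u_bounds by simp
    finally show ?thesis .
  qed
  have "exp (- b) \<le> 1 - b + 2115/100000 * u"
    using exp_minus_bounds(1)[OF b(1)] b2 by linarith
  \<comment> \<open>The coefficient of u is raised to make room for b * u, so that the target's
    factor 1 - b splits off.\<close>
  also have "\<dots> \<le> 1 - b + 233/10000 * u - 233/10000 * (b * u)"
    using mult_right_mono[OF b(2) less_imp_le[OF u_bounds(1)]] u_bounds(1) by linarith
  also have "\<dots> = (1 - b) * (1 + 233/10000 * u)"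
    by (simp add: field_simps)
  finally have eb: "exp (- b) \<le> (1 - b) * (1 + 233/10000 * u)" .
  have "exp g \<le> 1 + g + g\<^sup>2"
    using g by (intro exp_bound) auto
  also have "g\<^sup>2 \<le> 363/10000 * (1941/10000 * u)"
    unfolding power2_eq_square using g by (intro mult_mono) auto
  finally have eg: "exp g \<le> 1 + 2013/10000 * u"
    using g u_bounds by linarith
  have u2: "u * u \<le> 64/343 * u"
    using u_bounds by (intro mult_right_mono) auto
  have "exp (- b + g) \<le> ((1 - b) * (1 + 233/10000 * u)) * (1 + 2013/10000 * u)"
    unfolding exp_add using eb eg b u_bounds by (intro mult_mono mult_nonneg_nonneg) auto
  also have "\<dots> = (1 - b) * ((1 + 233/10000 * u) * (1 + 2013/10000 * u))"
    by simp
  also have "(1 + 233/10000 * u) * (1 + 2013/10000 * u) = 1 + 2246/10000 * u + 469029/100000000 * (u * u)"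
    by (simp add: field_simps)
  also have "(1 - b) * \<dots> \<le> (1 - b) * (1 + 2256/10000 * u)"
    by (rule mult_left_mono, use u2 u_bounds in linarith, use b in linarith)
  finally have third: "exp (- b + g) \<le> (1 - b) * (1 + 2256/10000 * u)" .
  have second: "exp (- 5/4 * ln (1 - t\<^sup>2)) \<le> ?A * (1 + 6/25 * u)"
    using exp_ln_one_minus_upper[OF _ t2] cubic_le by simp
  have A: "0 < ?A" by (intro add_pos_nonneg) auto
  have ua: "4758/10000 * u \<le> a\<^sup>2 / 2" using Du u_bounds by linarith
  have pos: "0 \<le> 1 - a + a\<^sup>2 / 2" using a_le a by (intro add_nonneg_nonneg) auto
  have "exp (- a) * exp (- 5/4 * ln (1 - t\<^sup>2)) * exp (- b + g)
     \<le> (1 - a + a\<^sup>2 / 2) * (?A * (1 + 6/25 * u)) * ((1 - b) * (1 + 2256/10000 * u))"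
    using exp_minus_bounds(1)[of a] a A b u_bounds second third pos
    by (intro mult_mono mult_nonneg_nonneg) auto
  also have "\<dots> = ?A * (1 - b) * ((1 - a + a\<^sup>2 / 2) * ((1 + 6/25 * u) * (1 + 2256/10000 * u)))"
    by (simp add: mult_ac)
  also have "\<dots> \<le> ?A * (1 - b) * ((1 - a + a\<^sup>2 / 2) * (1 + 4758/10000 * u))"
  proof (intro mult_left_mono)
    have "(1 + 6/25 * u) * (1 + 2256/10000 * u) = 1 + 4656/10000 * u + 13536/250000 * (u * u)"
      by (simp add: field_simps)
    then show "(1 + 6/25 * u) * (1 + 2256/10000 * u) \<le> 1 + 4758/10000 * u"
      using u2 u_bounds by linarith
  qed (use pos A b in auto)
  also have "\<dots> \<le> ?A * (1 - b) * (1 - a + a\<^sup>2)"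
  proof (intro mult_left_mono)
    have "1 - a + a\<^sup>2 / 2 \<le> 1"
      using mult_right_mono[OF a_le less_imp_le[OF a]] a by (simp add: power2_eq_square)
    then have "(1 - a + a\<^sup>2 / 2) * (4758/10000 * u) \<le> 1 * (4758/10000 * u)"
      using u_bounds by (intro mult_right_mono) auto
    also have "\<dots> \<le> a\<^sup>2 / 2" using ua by simp
    finally have "(1 - a + a\<^sup>2 / 2) + (1 - a + a\<^sup>2 / 2) * (4758/10000 * u) \<le> (1 - a + a\<^sup>2 / 2) + a\<^sup>2 / 2"
      by (rule add_left_mono)
    then show "(1 - a + a\<^sup>2 / 2) * (1 + 4758/10000 * u) \<le> 1 - a + a\<^sup>2"
      by (simp add: distrib_left)
  qed (use A b in auto)
  also have "\<dots> = ?A * (1 - a + a\<^sup>2) * (1 - b)"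
    by simp
  \<comment> \<open>The positive term 292 * u / D^3 supplies strictness.\<close>
  also have "\<dots> < ?A * (1 - a + a\<^sup>2) * (1 - b + 292 * u / D^3)"
    using A a a_le u_bounds D by (intro mult_strict_left_mono mult_pos_pos) (auto intro: add_pos_nonneg)
  finally show ?thesis
    by (simp add: b_def g_def)
qed

text \<open>With c = a (1 + 5/8 t^2), the target uses 1 - c, so exp (-c) yields a gain c^2/2 -
  c^3/6. It must outweigh \<delta> + g - h, the part of the exponent not matched by the third factor
  of the target, which is at most of order a^2.\<close>

lemma lower:
  "(1 + 5/4 * t\<^sup>2 + 45/32 * t^4) * (1 - a * (1 + 5/8 * t\<^sup>2))
      * (1 - 45/8 * (a * t / D) - 15/8 * u / D - 300 * u / D^3)
    < exp (- (a * (1 + 5/8 * t\<^sup>2))) * exp (- 5/4 * ln (1 - t\<^sup>2))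
      * exp (- (45/8 * (a * t / D) + 6 * u * (a / D) + 5 * u / (D * (1 - t\<^sup>2))))"
proof -
  define b where "b = 45/8 * (a * t / D)"
  define g where "g = 5 * u / (D * (1 - t\<^sup>2))"
  define \<delta> where "\<delta> = 6 * u * (a / D)"
  define h where "h = 15/8 * u / D + 300 * u / D^3"
  define c where "c = a * (1 + 5/8 * t\<^sup>2)"
  let ?A = "1 + 5/4 * t\<^sup>2 + 45/32 * t^4"
  have ua: "u \<le> 1046/1000 * a\<^sup>2" using Du u_bounds by linarith
  have aa: "a\<^sup>2 \<le> 43/100 * a"
    using mult_right_mono[OF a_le less_imp_le[OF a]] a by (simp add: power2_eq_square)
  have b: "0 \<le> b" "b \<le> 2102/10000 * a"
    using at_div_D a by (auto simp: b_def)
  have c: "a \<le> c" "c \<le> 1205/1000 * a"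
    using mult_left_mono[OF t2 less_imp_le[OF a]] a by (auto simp: c_def algebra_simps)
  have h: "1947/10000 * u \<le> h"
  proof -
    have "15/8 * u / (158/10) \<le> 15/8 * u / D"
      by (rule divide_left_mono) (use u_bounds D in auto)
    moreover have "300 * u / (158/10)^3 \<le> 300 * u / D^3"
      by (rule divide_left_mono, rule power_mono) (use u_bounds D in auto)
    moreover have "15/8 * u / (158/10) = 75/632 * u" "300 * u / (158/10)^3 = 37500/493039 * u"
      by (simp_all add: power_divide)
    ultimately show ?thesis
      unfolding h_def using u_bounds by argo
  qed
  have \<delta>: "0 \<le> \<delta>" "\<delta> \<le> 3922/10000 * (a * u)"
  proof -
    have "\<delta> = 6 * (u * a / D)"
      by (simp add: \<delta>_def)
    also have "\<dots> \<le> 6 * (u * a / (153/10))"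
      using u_bounds a D by (intro mult_left_mono divide_left_mono) auto
    also have "\<dots> \<le> 3922/10000 * (a * u)"
      using u_bounds a by simp
    finally show "\<delta> \<le> 3922/10000 * (a * u)" .
    show "0 \<le> \<delta>" using u_bounds a D by (simp add: \<delta>_def)
  qed
  have g: "0 \<le> g" "g \<le> 3268/10000 * u + 376/1000 * (a * u)"
  proof -
    have t2a: "t\<^sup>2 \<le> 774/1000 * a"
    proof (rule power2_le_imp_le)
      have "(t\<^sup>2)\<^sup>2 = t * u" by (simp add: u eval_nat_numeral)
      also have "\<dots> \<le> 4/7 * u" using t u_bounds by (intro mult_right_mono) auto
      also have "\<dots> \<le> (774/1000 * a)\<^sup>2"
        using ua mult_pos_pos[OF a a] by (simp add: power2_eq_square)
      finally show "(t\<^sup>2)\<^sup>2 \<le> (774/1000 * a)\<^sup>2" .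
    qed (use a in simp)
    \<comment> \<open>From 1/(1 - e) = 1 + e/(1 - e) with 1 - e at least 33/49; the correction is
      then measured in a through \<open>t2a\<close>.\<close>
    have "1 / (1 - t\<^sup>2) \<le> 1 + 49/33 * t\<^sup>2"
      using t2 mult_right_mono[OF t2, of "t\<^sup>2"] by (simp add: field_simps)
    also have "\<dots> \<le> 1 + 1150/1000 * a" using t2a a by linarith
    finally have "5 * u / D * (1 / (1 - t\<^sup>2)) \<le> 5 * u / (153/10) * (1 + 1150/1000 * a)"
      using u_bounds D t2 by (intro mult_mono divide_left_mono) auto
    then show "g \<le> 3268/10000 * u + 376/1000 * (a * u)"
      using u_bounds mult_pos_pos[OF a u_bounds(1)] by (simp add: g_def algebra_simps)
    show "0 \<le> g" using u_bounds D t2 by (simp add: g_def)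
  qed
  have au: "a * u \<le> 1046/1000 * (a * a\<^sup>2)"
    using mult_left_mono[OF ua less_imp_le[OF a]] by simp
  have loss: "\<delta> + g - h \<le> a\<^sup>2 * (1382/10000 + 804/1000 * a)"
  proof -
    have "\<delta> + g - h \<le> 1321/10000 * u + 7682/10000 * (a * u)"
      using h \<delta> g by linarith
    also have "\<dots> \<le> 1321/10000 * (1046/1000 * a\<^sup>2) + 7682/10000 * (1046/1000 * (a * a\<^sup>2))"
      using ua au by (intro add_mono mult_left_mono) auto
    also have "\<dots> = a\<^sup>2 * (1321/10000 * (1046/1000) + 7682/10000 * (1046/1000) * a)"
      by (simp only: distrib_left mult_ac)
    also have "\<dots> \<le> a\<^sup>2 * (1382/10000 + 804/1000 * a)"
      using a by (intro mult_left_mono) auto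
    finally show ?thesis .
  qed
  have total: "b + \<delta> + g \<le> 52/100 * a"
  proof -
    have "a * u \<le> a * (64/343)" using u_bounds a by (intro mult_left_mono) auto
    moreover have "u \<le> 4498/10000 * a" using ua aa a by linarith
    ultimately show ?thesis using b \<delta> g a by linarith
  qed
  have key: "(1 - c) * (1 - b - h) < (1 - c + c\<^sup>2 / 2 - c^3 / 6) * (1 - (b + \<delta> + g))"
  proof -
    have "(1 - c) * (\<delta> + g - h) \<le> (1 - c) * (a\<^sup>2 * (1382/10000 + 804/1000 * a))"
      using loss c a_le by (intro mult_left_mono) auto
    also have "\<dots> \<le> (1 - a) * (a\<^sup>2 * (1382/10000 + 804/1000 * a))"
      using c a by (intro mult_right_mono) auto
    \<comment> \<open>The constant 201/1000 bounds 1205/6000, which comes from c/6, and 52/100 is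
      the bound in \<open>total\<close>. The margin is expanded about the endpoint a = 43/100, where
      the remaining linear part is still positive.\<close>
    also have "\<dots> < (a\<^sup>2 * (1/2 - 201/1000 * a)) * (1 - 52/100 * a)"
    proof -
      have "(1/2 - 201/1000 * a) * (1 - 52/100 * a) - (1 - a) * (1382/10000 + 804/1000 * a)
          = 22713/25000 * (a - 43/100)\<^sup>2 + (48453663/250000000 - 431841/1250000 * a)"
        by (simp add: power2_eq_square field_simps)
      also have "0 < \<dots>"
        using a_le by (intro add_nonneg_pos) auto
      finally have "0 < (1/2 - 201/1000 * a) * (1 - 52/100 * a) - (1 - a) * (1382/10000 + 804/1000 * a)" .
      then have "0 < a\<^sup>2 * ((1/2 - 201/1000 * a) * (1 - 52/100 * a) - (1 - a) * (1382/10000 + 804/1000 * a))"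
        using a by (intro mult_pos_pos) auto
      then show ?thesis by (simp add: algebra_simps)
    qed
    also have "\<dots> \<le> (c\<^sup>2 / 2 - c^3 / 6) * (1 - (b + \<delta> + g))"
    proof (intro mult_mono)
      have "a\<^sup>2 * (1/2 - 201/1000 * a) \<le> c\<^sup>2 * (1/2 - c / 6)"
        using a c a_le by (intro mult_mono power_mono) auto
      also have "\<dots> = c\<^sup>2 / 2 - c^3 / 6"
        by (simp add: algebra_simps eval_nat_numeral)
      finally show "a\<^sup>2 * (1/2 - 201/1000 * a) \<le> c\<^sup>2 / 2 - c^3 / 6" .
      have "0 \<le> c\<^sup>2 * (1/2 - c / 6)"
        using a c a_le by (intro mult_nonneg_nonneg) auto
      then show "0 \<le> c\<^sup>2 / 2 - c^3 / 6"
        by (simp add: algebra_simps eval_nat_numeral)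
    qed (use total a_le in auto)
    finally have "0 < (c\<^sup>2 / 2 - c^3 / 6) * (1 - (b + \<delta> + g)) - (1 - c) * (\<delta> + g - h)"
      by simp
    also have "\<dots> = (1 - c + c\<^sup>2 / 2 - c^3 / 6) * (1 - (b + \<delta> + g)) - (1 - c) * (1 - b - h)"
      by (simp add: field_simps)
    finally show ?thesis by simp
  qed
  have A: "0 < ?A" by (intro add_pos_nonneg) auto
  have second: "?A \<le> exp (- 5/4 * ln (1 - t\<^sup>2))"
    using exp_ln_one_minus_lower[of "t\<^sup>2"] t2 by (simp flip: power_mult)
  have first: "1 - c + c\<^sup>2 / 2 - c^3 / 6 \<le> exp (- c)"
    using c a by (intro exp_minus_bounds(2)) simp
  have third: "1 - (b + \<delta> + g) \<le> exp (- (b + \<delta> + g))"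
    using exp_ge_add_one_self[of "- (b + \<delta> + g)"] by linarith
  have third_pos: "0 \<le> 1 - (b + \<delta> + g)" using total a_le by simp
  have "?A * (1 - c) * (1 - b - h) < ?A * ((1 - c + c\<^sup>2 / 2 - c^3 / 6) * (1 - (b + \<delta> + g)))"
    using key A by simp
  also have "\<dots> \<le> exp (- 5/4 * ln (1 - t\<^sup>2)) * (exp (- c) * exp (- (b + \<delta> + g)))"
  proof (rule mult_mono[OF second])
    show "(1 - c + c\<^sup>2 / 2 - c^3 / 6) * (1 - (b + \<delta> + g)) \<le> exp (- c) * exp (- (b + \<delta> + g))"
      using first third third_pos by (intro mult_mono) auto
    have "0 \<le> (1 - c) + c\<^sup>2 * (1/2 - c / 6)"
      using a c a_le by (intro add_nonneg_nonneg mult_nonneg_nonneg) auto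
    then have "0 \<le> 1 - c + c\<^sup>2 / 2 - c^3 / 6"
      by (simp add: algebra_simps eval_nat_numeral)
    then show "0 \<le> (1 - c + c\<^sup>2 / 2 - c^3 / 6) * (1 - (b + \<delta> + g))"
      using third_pos by simp
  qed simp
  finally show ?thesis
    by (simp add: b_def g_def \<delta>_def h_def c_def mult_ac diff_diff_eq add.assoc)
qed

end

section \<open>The theorem\<close>

text \<open>The theorem with x and \<alpha> merged into s = sqrt \<alpha> * x. The ratio is the
  exponential of a second difference of \<open>L\<close>; the terms of \<phi> are estimated
  separately and the sum is fed to the reduced inequality.\<close>

lemma hyp_ratio_bounds:
  fixes s t D :: real
  assumes s: "0 < s" and t: "0 < t" "t \<le> 4/7" and D: "s\<^sup>2 * t = D" "153/10 \<le> D" "D \<le> 158/10"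
  defines "R \<equiv> hyp 2 (s\<^sup>2 * (1 - t) / 4) * hyp 2 (s\<^sup>2 * (1 + t) / 4) / (hyp 2 (s\<^sup>2 / 4))\<^sup>2"
  shows "R < (1 + 5/4 * t\<^sup>2 + 27/16 * t^4) * (1 - s * t\<^sup>2 / 4 + s\<^sup>2 * t^4 / 16)
           * (1 - 45/32 * t\<^sup>2 / s + 292 / s^6)" (is ?upper)
    and "(1 + 5/4 * t\<^sup>2 + 45/32 * t^4) * (1 - s * t\<^sup>2 / 4 - 5/32 * s * t^4)
           * (1 - 45/32 * t\<^sup>2 / s - 15/8 * t\<^sup>2 / s\<^sup>2 - 300 / s^6) < R" (is ?lower)
proof -
  define a where "a = s * t\<^sup>2 / 4"
  have t1: "t < 1" using t by simp
  interpret c: reduced a t D "t^3"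
    by unfold_locales (use s t D in \<open>auto simp: a_def power2_eq_square eval_nat_numeral\<close>)
  have vt: "0 < s\<^sup>2 * t" "s\<^sup>2 * t < s\<^sup>2" using s t by auto
  \<comment> \<open>Negative powers of s are traded for powers of t by D = s^2 t.\<close>
  have t_s2: "t / s\<^sup>2 = t\<^sup>2 / D" and t_s: "t\<^sup>2 / s = 4 * (a * t / D)" and t4_s: "t^4 / s = 4 * (t^3 * (a / D))"
    and u_s2: "t\<^sup>2 / s\<^sup>2 = t^3 / D" and u_s6: "1 / s^6 = t^3 / D^3"
    unfolding D(1)[symmetric] a_def using s t by (simp_all add: field_simps eval_nat_numeral)
  have core_eq: "s * t\<^sup>2 / 4 = a" "s\<^sup>2 * t^4 / 16 = a\<^sup>2" "5/32 * s * t^4 = a * (5/8 * t\<^sup>2)"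
      "45/32 * t\<^sup>2 / s = 45/8 * (a * t / D)" "15/8 * t\<^sup>2 / s\<^sup>2 = 15/8 * t^3 / D" "c / s^6 = c * t^3 / D^3" for c
    using t_s arg_cong[OF u_s2, of "\<lambda>y. 15/8 * y"] arg_cong[OF u_s6, of "\<lambda>y. c * y"]
    by (simp_all add: a_def power2_eq_square eval_nat_numeral)
  have R: "R = exp (L (s\<^sup>2 - s\<^sup>2 * t) + L (s\<^sup>2 + s\<^sup>2 * t) - 2 * L (s\<^sup>2))"
  proof -
    have "exp (L v) = hyp 2 (v / 4)" if "0 \<le> v" for v
      using hyp_pos[of "v / 4" 2] that by (simp add: L_def)
    then show ?thesis
      using vt by (simp add: R_def exp_diff exp_add exp_double right_diff_distrib distrib_left)
  qed
  have "R \<le> exp (- a) * exp (- 5/4 * ln (1 - t\<^sup>2)) * exp (- 45/8 * (a * t / D) + 2 * t^3 / (D * (1 - t\<^sup>2)))"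
  proof -
    have "s * (sqrt (1 + t) + sqrt (1 - t) - 2) \<le> s * (- t\<^sup>2 / 4)"
      using s sum_sqrt_upper[OF t(1) t1] by (intro mult_left_mono) auto
    moreover have "15 / (8 * s) * (3/4 * t\<^sup>2) \<le> 15 / (8 * s) * (1 / sqrt (1 + t) + 1 / sqrt (1 - t) - 2)"
      using s sum_inv_sqrt_lower[OF t(1) t1] by (intro mult_left_mono) auto
    moreover have "15 / (8 * s) * (3/4 * t\<^sup>2) = 45/8 * (a * t / D)"
      using t_s by simp
    moreover have "1 * (2 * t\<^sup>2 / (s\<^sup>2 * (1 - t\<^sup>2))) = 2 * t^3 / (D * (1 - t\<^sup>2))"
      using arg_cong[OF u_s2, of "\<lambda>x. 2 * x / (1 - t\<^sup>2)"] by simp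
    moreover have "s * (- t\<^sup>2 / 4) = - a"
      by (simp add: a_def)
    ultimately have "L (s\<^sup>2 - s\<^sup>2 * t) + L (s\<^sup>2 + s\<^sup>2 * t) - 2 * L (s\<^sup>2)
        \<le> - a + - 5/4 * ln (1 - t\<^sup>2) + (- 45/8 * (a * t / D) + 2 * t^3 / (D * (1 - t\<^sup>2)))"
      using second_difference_L(1)[OF vt] unfolding phi_second_difference[OF s t(1) t1] by linarith
    then show ?thesis unfolding R exp_add[symmetric] by simp
  qed
  also note c.upper
  finally show ?upper
    unfolding core_eq .
  have "exp (- (a * (1 + 5/8 * t\<^sup>2))) * exp (- 5/4 * ln (1 - t\<^sup>2))
      * exp (- (45/8 * (a * t / D) + 6 * t^3 * (a / D) + 5 * t^3 / (D * (1 - t\<^sup>2)))) \<le> R"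
  proof -
    have "s * (- t\<^sup>2 / 4 - 5/32 * t^4) \<le> s * (sqrt (1 + t) + sqrt (1 - t) - 2)"
      using s sum_sqrt_lower[OF t] by (intro mult_left_mono) auto
    moreover have "15 / (8 * s) * (1 / sqrt (1 + t) + 1 / sqrt (1 - t) - 2) \<le> 15 / (8 * s) * (3/4 * t\<^sup>2 + 4/5 * t^4)"
      using s sum_inv_sqrt_upper[OF t] by (intro mult_left_mono) auto
    moreover have "15 / (8 * s) * (3/4 * t\<^sup>2 + 4/5 * t^4) = 45/32 * (t\<^sup>2 / s) + 3/2 * (t^4 / s)"
      using s by (simp add: field_simps)
    moreover have "45/32 * (t\<^sup>2 / s) = 45/8 * (a * t / D)" "3/2 * (t^4 / s) = 6 * t^3 * (a / D)"
      unfolding t_s t4_s by simp_all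
    moreover have "- (5/2) * (2 * t\<^sup>2 / (s\<^sup>2 * (1 - t\<^sup>2))) = - (5 * t^3 / (D * (1 - t\<^sup>2)))"
      using arg_cong[OF u_s2, of "\<lambda>y. 5 * y / (1 - t\<^sup>2)"] by simp
    moreover have "s * (- t\<^sup>2 / 4 - 5/32 * t^4) = - (a * (1 + 5/8 * t\<^sup>2))"
      by (simp add: a_def algebra_simps eval_nat_numeral)
    ultimately have "- (a * (1 + 5/8 * t\<^sup>2)) + - 5/4 * ln (1 - t\<^sup>2)
        + - (45/8 * (a * t / D) + 6 * t^3 * (a / D) + 5 * t^3 / (D * (1 - t\<^sup>2)))
        \<le> L (s\<^sup>2 - s\<^sup>2 * t) + L (s\<^sup>2 + s\<^sup>2 * t) - 2 * L (s\<^sup>2)"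
      using second_difference_L(2)[OF vt] unfolding phi_second_difference[OF s t(1) t1] by linarith
    then show ?thesis unfolding R exp_add[symmetric] by simp
  qed
  note less_le_trans[OF c.lower this]
  moreover have "1 - a - a * (5/8 * t\<^sup>2) = 1 - a * (1 + 5/8 * t\<^sup>2)"
    by (simp add: algebra_simps)
  ultimately show ?lower
    unfolding core_eq by (simp only:)
qed

theorem theorem3p1:
  fixes k :: nat and n :: int
  assumes "k \<in> {1, 2}" and "n \<ge> 2"
  shows "let x = x_k k n; \<alpha> = alpha_k k in
    Lambda_k k n <
      (1 + 5 * pi ^ 4 / (9 * x ^ 4) + pi ^ 8 / (3 * x ^ 8)) *
      (1 - sqrt \<alpha> * pi ^ 4 / (9 * x ^ 3) + \<alpha> * pi ^ 8 / (81 * x ^ 6)) *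
      (1 - 5 * pi ^ 4 / (8 * sqrt \<alpha> * x ^ 5) + 292 / (\<alpha> ^ 3 * x ^ 6)) \<and>
    Lambda_k k n >
      (1 + 5 * pi ^ 4 / (9 * x ^ 4) + 5 * pi ^ 8 / (18 * x ^ 8)) *
      (1 - sqrt \<alpha> * pi ^ 4 / (9 * x ^ 3) - 5 * sqrt \<alpha> * pi ^ 8 / (162 * x ^ 7)) *
      (1 - 5 * pi ^ 4 / (8 * sqrt \<alpha> * x ^ 5) - 5 * pi ^ 4 / (6 * \<alpha> * x ^ 6) - 300 / (\<alpha> ^ 3 * x ^ 6))"
proof -
  define N :: real where "N = 24 * of_int n - (2 * real k + 2)"
  define t where "t = 24 / N"
  define x where "x = x_k k n"
  define \<alpha> where "\<alpha> = alpha_k k"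
  define s where "s = sqrt \<alpha> * x"
  define D where "D = 2 * \<alpha> * pi\<^sup>2 / 3"
  have k: "k = 1 \<or> k = 2" using assms(1) by auto
  have n: "(2::real) \<le> of_int n" using assms(2) by simp
  have N: "42 \<le> N" using k n unfolding N_def by auto
  have t: "0 < t" "t \<le> 4/7" using N by (auto simp: t_def field_simps)
  have \<alpha>: "7/3 \<le> \<alpha>" "\<alpha> \<le> 12/5" using k by (auto simp: \<alpha>_def alpha_k_def)
  have x: "0 < x" and x2: "x\<^sup>2 = pi\<^sup>2 * N / 36"
    using N by (simp_all add: x_def x_k_def N_def[symmetric] power_divide power_mult_distrib)
  have s: "0 < s" and s2: "s\<^sup>2 = \<alpha> * x\<^sup>2" and sqrt_\<alpha>: "sqrt \<alpha> = s / x" and \<alpha>_s: "\<alpha> = s\<^sup>2 / x\<^sup>2"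
    using \<alpha> x by (auto simp: s_def power_mult_distrib)
  \<comment> \<open>This identity removes pi: after it every term of the bounds depends only on s
    and t.\<close>
  have pi_sq: "pi\<^sup>2 = 3/2 * x\<^sup>2 * t"
    using N by (simp add: x2 t_def)
  have D_eq: "s\<^sup>2 * t = D"
    unfolding s2 D_def pi_sq by simp
  have "(314/100)\<^sup>2 \<le> pi\<^sup>2" "pi\<^sup>2 \<le> (31416/10000)\<^sup>2"
    using pi_approx by (auto intro!: power_mono)
  then have pi_bounds: "98596/10000 \<le> pi\<^sup>2" "pi\<^sup>2 \<le> 986966/100000"
    by (simp_all add: power2_eq_square)
  \<comment> \<open>The actual values are about 15.35 for k = 1 and 15.79 for k = 2.\<close>
  have D: "153/10 \<le> D" "D \<le> 158/10"
  proof -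
    have "7/3 * (98596/10000) \<le> \<alpha> * pi\<^sup>2" "\<alpha> * pi\<^sup>2 \<le> 12/5 * (986966/100000)"
      using \<alpha> pi_bounds by (intro mult_mono; simp)+
    then show "153/10 \<le> D" "D \<le> 158/10" by (simp_all add: D_def)
  qed
  define C where "C = \<alpha>\<^sup>2 * pi^3 / 72"
  \<comment> \<open>The factor x^2 from (s/2)^2 cancels the prefactor 1/x^2, leaving a constant that
    drops out of the ratio. The range starts at m = 1 because n - 1 = 1 occurs; the radicand is
    positive there.\<close>
  have M: "M_k k m = C * hyp 2 (\<alpha> * (x_k k m)\<^sup>2 / 4)" if "1 \<le> m" for m
  proof -
    have "(1::real) \<le> of_int m" using that by simp
    then have "0 < x_k k m" using k by (auto simp: x_k_def)
    then show ?thesis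
      using \<alpha> by (simp add: M_k_def bessel_I_eq_hyp power_mult_distrib power_divide \<alpha>_def[symmetric])
        (simp add: C_def power2_eq_square)
  qed
  have xm: "(x_k k (n - 1))\<^sup>2 = x\<^sup>2 * (1 - t)" "(x_k k (n + 1))\<^sup>2 = x\<^sup>2 * (1 + t)"
  proof -
    have "24 * of_int (n - 1) - (2 * real k + 2) = N * (1 - t)" "24 * of_int (n + 1) - (2 * real k + 2) = N * (1 + t)"
      using N by (simp_all add: N_def[symmetric] t_def right_diff_distrib distrib_left) (simp_all add: N_def)
    then show "(x_k k (n - 1))\<^sup>2 = x\<^sup>2 * (1 - t)" "(x_k k (n + 1))\<^sup>2 = x\<^sup>2 * (1 + t)"
      using N t by (simp_all add: x_k_def x2 power_divide power_mult_distrib)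
  qed
  have \<Lambda>: "Lambda_k k n = hyp 2 (s\<^sup>2 * (1 - t) / 4) * hyp 2 (s\<^sup>2 * (1 + t) / 4) / (hyp 2 (s\<^sup>2 / 4))\<^sup>2"
  proof -
    have "\<alpha> * (x_k k n)\<^sup>2 = s\<^sup>2" "\<alpha> * (x_k k (n - 1))\<^sup>2 = s\<^sup>2 * (1 - t)" "\<alpha> * (x_k k (n + 1))\<^sup>2 = s\<^sup>2 * (1 + t)"
      unfolding xm s2 by (simp_all add: x_def)
    then have "M_k k n = C * hyp 2 (s\<^sup>2 / 4)"
        "M_k k (n - 1) = C * hyp 2 (s\<^sup>2 * (1 - t) / 4)"
        "M_k k (n + 1) = C * hyp 2 (s\<^sup>2 * (1 + t) / 4)"
      using M assms(2) by simp_all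
    moreover have "C \<noteq> 0" using \<alpha> by (simp add: C_def)
    ultimately show ?thesis
      unfolding Lambda_k_def by (simp add: power2_eq_square)
  qed
  have pi4: "pi^4 = 9/4 * x^4 * t\<^sup>2" and pi8: "pi^8 = 81/16 * x^8 * t^4"
    using arg_cong[OF pi_sq, of "\<lambda>y. y\<^sup>2"] arg_cong[OF pi_sq, of "\<lambda>y. y^4"]
    by (simp_all add: power_mult_distrib power_divide flip: power_mult)
  have terms:
    "5 * pi^4 / (9 * x^4) = 5/4 * t\<^sup>2"
    "pi^8 / (3 * x^8) = 27/16 * t^4"
    "5 * pi^8 / (18 * x^8) = 45/32 * t^4"
    "sqrt \<alpha> * pi^4 / (9 * x^3) = s * t\<^sup>2 / 4"
    "\<alpha> * pi^8 / (81 * x^6) = s\<^sup>2 * t^4 / 16"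
    "5 * sqrt \<alpha> * pi^8 / (162 * x^7) = 5/32 * s * t^4"
    "5 * pi^4 / (8 * sqrt \<alpha> * x^5) = 45/32 * t\<^sup>2 / s"
    "5 * pi^4 / (6 * \<alpha> * x^6) = 15/8 * t\<^sup>2 / s\<^sup>2"
    "c / (\<alpha>^3 * x^6) = c / s^6" for c
    unfolding pi4 pi8 sqrt_\<alpha> unfolding \<alpha>_s using x s
    by (simp_all add: field_simps eval_nat_numeral)
  show ?thesis
    unfolding Let_def x_def[symmetric] \<alpha>_def[symmetric] \<Lambda> terms
    using hyp_ratio_bounds[OF s t D_eq D] by blast
qed

end
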